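(* Let $\mathcal C$ be a category equipped with an endomorphism $F$ of its identity functor. Then the twixing functor $\mathrm{twix}\colon t\mathcal C\to m\mathcal C$ factors as $$t\mathcal C\xrightarrow{\ \alpha\ } m\mathcal C[\mathrm{tdd}]\xrightarrow{\ \mathrm{forget}\ } m\mathcal C,$$ where $\alpha$ is an equivalence of categories and $\mathrm{forget}\colon(\hat X,f)\mapsto\hat X$ is the functor that forgets the descent datum.
   Context: An endomorphism $F$ of the identity functor of $\mathcal C$ is a family of endomorphisms $F_X\colon X\to X$, one for each object $X$, such that $F_Y\circ f=f\circ F_X$ for every morphism $f\colon X\to Y$. **Twisted category $t\mathcal C$.** Objects are pairs $(X,\varphi_X)$ with $X$ an object of $\mathcal C$ and $\varphi_X\in\mathrm{End}_{\mathcal C}(X)$ such that $\varphi_X\circ\varphi_X=F_X$. Morphisms $(X,\varphi_X)\to(Y,\varphi_Y)$ are morphisms $f\colon X\to Y$ of $\mathcal C$ with $\varphi_Y\circ f=f\circ\varphi_X$. **Mixed category $m\mathcal C$.** Objects are quadruples $\hat X=(X_1,X_2,\varphi_1,\varphi_2)$ with $X_1,X_2$ objects of $\mathcal C$ and morphisms $\varphi_1\colon X_1\to X_2$, $\varphi_2\colon X_2\to X_1$ such that $\varphi_2\circ\varphi_1=F_{X_1}$ and $\varphi_1\circ\varphi_2=F_{X_2}$. Morphisms $(X_1,X_2,\varphi_1,\varphi_2)\to(Y_1,Y_2,\psi_1,\psi_2)$ are pairs $(f_1,f_2)$ of morphisms $f_i\colon X_i\to Y_i$ with $\psi_1\circ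 f_1=f_2\circ\varphi_1$ and $\psi_2\circ f_2=f_1\circ\varphi_2$. **Twixing functor.** $\mathrm{twix}\colon t\mathcal C\to m\mathcal C$ sends $(X,\varphi_X)$ to $(X,X,\varphi_X,\varphi_X)$ and a morphism $f$ to $(f,f)$. **Twisting functor.** $\tau\colon m\mathcal C\to m\mathcal C$ sends $(X_1,X_2,\varphi_1,\varphi_2)$ to $(X_2,X_1,\varphi_2,\varphi_1)$ and $(f_1,f_2)$ to $(f_2,f_1)$. **Descent data.** A (twisted) descent datum on $\hat X\in m\mathcal C$ is a morphism $f\colon\hat X\to\tau\hat X$ in $m\mathcal C$ such that $\tau f\circ f=\mathrm{id}_{\hat X}$. The category $m\mathcal C[\mathrm{tdd}]$ has as objects pairs $(\hat X,f)$ with $\hat X$ an object of $m\mathcal C$ and $f$ a descent datum on $\hat X$; a morphism $(\hat X,f)\to(\hat Y,g)$ is an $m\mathcal C$-morphism $u\colon\hat X\to\hat Y$ such that $g\circ u=\tau u\circ f$. *)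

theory Defs
  imports Main
begin

(* The hom-sets of a category need not be disjoint, so identities and composition carry their
   objects as arguments: Comp C X Y Z g f is "g after f" for f : X -> Y and g : Y -> Z.
   Objects form a subset of a type; nothing is required of Hom, Ident and Comp outside it. *)

record ('o, 'm) cat =
  Ob :: "'o set"
  Hom :: "'o \<Rightarrow> 'o \<Rightarrow> 'm set"
  Ident :: "'o \<Rightarrow> 'm"
  Comp :: "'o \<Rightarrow> 'o \<Rightarrow> 'o \<Rightarrow> 'm \<Rightarrow> 'm \<Rightarrow> 'm"

locale category =
  fixes C :: "('o, 'm) cat"
  assumes Ident_in_Hom: "X \<in> Ob C \<Longrightarrow> Ident C X \<in> Hom C X X"
    and Comp_in_Hom: "\<lbrakk>X \<in> Ob C; Y \<in> Ob C; Z \<in> Ob C; f \<in> Hom C X Y; g \<in> Hom C Y Z\<rbrakk>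
      \<Longrightarrow> Comp C X Y Z g f \<in> Hom C X Z"
    and Comp_Ident_left: "\<lbrakk>X \<in> Ob C; Y \<in> Ob C; f \<in> Hom C X Y\<rbrakk>
      \<Longrightarrow> Comp C X Y Y (Ident C Y) f = f"
    and Comp_Ident_right: "\<lbrakk>X \<in> Ob C; Y \<in> Ob C; f \<in> Hom C X Y\<rbrakk>
      \<Longrightarrow> Comp C X X Y f (Ident C X) = f"
    and Comp_assoc: "\<lbrakk>W \<in> Ob C; X \<in> Ob C; Y \<in> Ob C; Z \<in> Ob C;
        f \<in> Hom C W X; g \<in> Hom C X Y; h \<in> Hom C Y Z\<rbrakk>
      \<Longrightarrow> Comp C W X Z (Comp C X Y Z h g) f = Comp C W Y Z h (Comp C W X Y g f)"

record ('o, 'm, 'p, 'n) fctr =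
  on_ob :: "'o \<Rightarrow> 'p"
  on_hom :: "'o \<Rightarrow> 'o \<Rightarrow> 'm \<Rightarrow> 'n"

locale cat_functor = A: category A + B: category B
  for A :: "('o, 'm) cat" and B :: "('p, 'n) cat" +
  fixes T :: "('o, 'm, 'p, 'n) fctr"
  assumes on_ob_in: "X \<in> Ob A \<Longrightarrow> on_ob T X \<in> Ob B"
    and on_hom_in: "\<lbrakk>X \<in> Ob A; Y \<in> Ob A; f \<in> Hom A X Y\<rbrakk>
      \<Longrightarrow> on_hom T X Y f \<in> Hom B (on_ob T X) (on_ob T Y)"
    and on_hom_Ident: "X \<in> Ob A \<Longrightarrow> on_hom T X X (Ident A X) = Ident B (on_ob T X)"
    and on_hom_Comp: "\<lbrakk>X \<in> Ob A; Y \<in> Ob A; Z \<in> Ob A; f \<in> Hom A X Y; g \<in> Hom A Y Z\<rbrakk>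
      \<Longrightarrow> on_hom T X Z (Comp A X Y Z g f) =
          Comp B (on_ob T X) (on_ob T Y) (on_ob T Z) (on_hom T Y Z g) (on_hom T X Y f)"

definition id_fctr :: "('o, 'm, 'o, 'm) fctr" where
  "id_fctr = \<lparr>on_ob = (\<lambda>X. X), on_hom = (\<lambda>X Y f. f)\<rparr>"

definition comp_fctr ::
  "('p, 'n, 'q, 'k) fctr \<Rightarrow> ('o, 'm, 'p, 'n) fctr \<Rightarrow> ('o, 'm, 'q, 'k) fctr" where
  "comp_fctr S T = \<lparr>on_ob = (\<lambda>X. on_ob S (on_ob T X)),
     on_hom = (\<lambda>X Y f. on_hom S (on_ob T X) (on_ob T Y) (on_hom T X Y f))\<rparr>"

(* Strict equality of functors with source A; values outside A are junk and are ignored. *)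
definition fctr_eq ::
  "('o, 'm) cat \<Rightarrow> ('o, 'm, 'p, 'n) fctr \<Rightarrow> ('o, 'm, 'p, 'n) fctr \<Rightarrow> bool" where
  "fctr_eq A S T \<longleftrightarrow>
     (\<forall>X\<in>Ob A. on_ob S X = on_ob T X) \<and>
     (\<forall>X\<in>Ob A. \<forall>Y\<in>Ob A. \<forall>f\<in>Hom A X Y. on_hom S X Y f = on_hom T X Y f)"

definition is_iso :: "('o, 'm) cat \<Rightarrow> 'o \<Rightarrow> 'o \<Rightarrow> 'm \<Rightarrow> bool" where
  "is_iso C X Y f \<longleftrightarrow> f \<in> Hom C X Y \<and>
     (\<exists>g\<in>Hom C Y X. Comp C X Y X g f = Ident C X \<and> Comp C Y X Y f g = Ident C Y)"

(* S and T are not required to be functors here; in cat_equivalence below they always are. *)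
definition natural_iso ::
  "('o, 'm) cat \<Rightarrow> ('p, 'n) cat \<Rightarrow> ('o, 'm, 'p, 'n) fctr \<Rightarrow> ('o, 'm, 'p, 'n) fctr
    \<Rightarrow> ('o \<Rightarrow> 'n) \<Rightarrow> bool" where
  "natural_iso A B S T \<eta> \<longleftrightarrow>
     (\<forall>X\<in>Ob A. is_iso B (on_ob S X) (on_ob T X) (\<eta> X)) \<and>
     (\<forall>X\<in>Ob A. \<forall>Y\<in>Ob A. \<forall>f\<in>Hom A X Y.
        Comp B (on_ob S X) (on_ob S Y) (on_ob T Y) (\<eta> Y) (on_hom S X Y f) =
        Comp B (on_ob S X) (on_ob T X) (on_ob T Y) (on_hom T X Y f) (\<eta> X))"

definition cat_equivalence ::
  "('o, 'm) cat \<Rightarrow> ('p, 'n) cat \<Rightarrow> ('o, 'm, 'p, 'n) fctr \<Rightarrow> bool" where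
  "cat_equivalence A B S \<longleftrightarrow> cat_functor A B S \<and>
     (\<exists>T \<eta> \<epsilon>. cat_functor B A T \<and>
        natural_iso A A id_fctr (comp_fctr T S) \<eta> \<and>
        natural_iso B B (comp_fctr S T) id_fctr \<epsilon>)"

definition id_endomorphism :: "('o, 'm) cat \<Rightarrow> ('o \<Rightarrow> 'm) \<Rightarrow> bool" where
  "id_endomorphism C F \<longleftrightarrow>
     (\<forall>X\<in>Ob C. F X \<in> Hom C X X) \<and>
     (\<forall>X\<in>Ob C. \<forall>Y\<in>Ob C. \<forall>f\<in>Hom C X Y. Comp C X Y Y (F Y) f = Comp C X X Y f (F X))"

definition tcat :: "('o, 'm) cat \<Rightarrow> ('o \<Rightarrow> 'm) \<Rightarrow> ('o \<times> 'm, 'm) cat" where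
  "tcat C F = \<lparr>
     Ob = {(X, \<phi>). X \<in> Ob C \<and> \<phi> \<in> Hom C X X \<and> Comp C X X X \<phi> \<phi> = F X},
     Hom = (\<lambda>(X, \<phi>) (Y, \<psi>). {f \<in> Hom C X Y. Comp C X Y Y \<psi> f = Comp C X X Y f \<phi>}),
     Ident = (\<lambda>(X, _). Ident C X),
     Comp = (\<lambda>(X, _) (Y, _) (Z, _). Comp C X Y Z)\<rparr>"

definition mcat ::
  "('o, 'm) cat \<Rightarrow> ('o \<Rightarrow> 'm) \<Rightarrow> ('o \<times> 'o \<times> 'm \<times> 'm, 'm \<times> 'm) cat" where
  "mcat C F = \<lparr>
     Ob = {(X1, X2, \<phi>1, \<phi>2). X1 \<in> Ob C \<and> X2 \<in> Ob C \<and> \<phi>1 \<in> Hom C X1 X2 \<and> \<phi>2 \<in> Hom C X2 X1 \<and>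
             Comp C X1 X2 X1 \<phi>2 \<phi>1 = F X1 \<and> Comp C X2 X1 X2 \<phi>1 \<phi>2 = F X2},
     Hom = (\<lambda>(X1, X2, \<phi>1, \<phi>2) (Y1, Y2, \<psi>1, \<psi>2).
             {(f1, f2). f1 \<in> Hom C X1 Y1 \<and> f2 \<in> Hom C X2 Y2 \<and>
                Comp C X1 Y1 Y2 \<psi>1 f1 = Comp C X1 X2 Y2 f2 \<phi>1 \<and>
                Comp C X2 Y2 Y1 \<psi>2 f2 = Comp C X2 X1 Y1 f1 \<phi>2}),
     Ident = (\<lambda>(X1, X2, _, _). (Ident C X1, Ident C X2)),
     Comp = (\<lambda>(X1, X2, _, _) (Y1, Y2, _, _) (Z1, Z2, _, _) (g1, g2) (f1, f2).
              (Comp C X1 Y1 Z1 g1 f1, Comp C X2 Y2 Z2 g2 f2))\<rparr>"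

definition twix :: "('o \<times> 'm, 'm, 'o \<times> 'o \<times> 'm \<times> 'm, 'm \<times> 'm) fctr" where
  "twix = \<lparr>on_ob = (\<lambda>(X, \<phi>). (X, X, \<phi>, \<phi>)), on_hom = (\<lambda>_ _ f. (f, f))\<rparr>"

definition twist ::
  "('o \<times> 'o \<times> 'm \<times> 'm, 'm \<times> 'm, 'o \<times> 'o \<times> 'm \<times> 'm, 'm \<times> 'm) fctr" where
  "twist = \<lparr>on_ob = (\<lambda>(X1, X2, \<phi>1, \<phi>2). (X2, X1, \<phi>2, \<phi>1)),
     on_hom = (\<lambda>_ _ (f1, f2). (f2, f1))\<rparr>"

definition descent_datum ::
  "('o, 'm) cat \<Rightarrow> ('o \<Rightarrow> 'm) \<Rightarrow> ('o \<times> 'o \<times> 'm \<times> 'm) \<Rightarrow> ('m \<times> 'm) \<Rightarrow> bool" where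
  "descent_datum C F X f \<longleftrightarrow>
     f \<in> Hom (mcat C F) X (on_ob twist X) \<and>
     Comp (mcat C F) X (on_ob twist X) X (on_hom twist X (on_ob twist X) f) f
       = Ident (mcat C F) X"

definition mcat_tdd ::
  "('o, 'm) cat \<Rightarrow> ('o \<Rightarrow> 'm) \<Rightarrow> (('o \<times> 'o \<times> 'm \<times> 'm) \<times> ('m \<times> 'm), 'm \<times> 'm) cat" where
  "mcat_tdd C F = \<lparr>
     Ob = {(X, f). X \<in> Ob (mcat C F) \<and> descent_datum C F X f},
     Hom = (\<lambda>(X, f) (Y, g). {u \<in> Hom (mcat C F) X Y.
             Comp (mcat C F) X Y (on_ob twist Y) g u =
             Comp (mcat C F) X (on_ob twist X) (on_ob twist Y) (on_hom twist X Y u) f}),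
     Ident = (\<lambda>(X, _). Ident (mcat C F) X),
     Comp = (\<lambda>(X, _) (Y, _) (Z, _). Comp (mcat C F) X Y Z)\<rparr>"

definition forget_tdd ::
  "(('o \<times> 'o \<times> 'm \<times> 'm) \<times> ('m \<times> 'm), 'm \<times> 'm, 'o \<times> 'o \<times> 'm \<times> 'm, 'm \<times> 'm) fctr" where
  "forget_tdd = \<lparr>on_ob = (\<lambda>(X, f). X), on_hom = (\<lambda>_ _ u. u)\<rparr>"

end

theory Submission
  imports Defs
begin

text \<open>A descent datum on \<open>(X1, X2, \<phi>1, \<phi>2)\<close> is a pair \<open>(f1, f2)\<close> of mutually inverse
  isomorphisms with \<open>\<phi>2 f1 = f2 \<phi>1\<close> and \<open>\<phi>1 f2 = f1 \<phi>2\<close>. Hence \<open>\<phi>2 f1\<close> is a square root of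
  \<open>F\<close> on \<open>X1\<close>, which gives a quasi-inverse to
  \<open>\<alpha> (X, \<phi>) = ((X, X, \<phi>, \<phi>), (id, id))\<close>, and \<open>(id, f1)\<close> is an isomorphism from
  \<open>\<alpha> (X1, \<phi>2 f1)\<close> to the original object.\<close>

definition twix_tdd ::
  "('o, 'm) cat \<Rightarrow>
    ('o \<times> 'm, 'm, ('o \<times> 'o \<times> 'm \<times> 'm) \<times> ('m \<times> 'm), 'm \<times> 'm) fctr" where
  "twix_tdd C = \<lparr>on_ob = (\<lambda>(X, \<phi>). ((X, X, \<phi>, \<phi>), (Ident C X, Ident C X))),
     on_hom = (\<lambda>_ _ f. (f, f))\<rparr>"

text \<open>No information is lost in keeping only \<open>u1\<close> of a morphism
  \<open>(u1, u2)\<close>: compatibility with the data, \<open>g1 u1 = u2 f1\<close>, forces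
  \<open>u2 = g1 u1 f2\<close>.\<close>

definition untwix_tdd ::
  "('o, 'm) cat \<Rightarrow>
    (('o \<times> 'o \<times> 'm \<times> 'm) \<times> ('m \<times> 'm), 'm \<times> 'm, 'o \<times> 'm, 'm) fctr" where
  "untwix_tdd C = \<lparr>on_ob = (\<lambda>((X1, X2, \<phi>1, \<phi>2), (f1, f2)). (X1, Comp C X1 X2 X1 \<phi>2 f1)),
     on_hom = (\<lambda>_ _ u. fst u)\<rparr>"

lemma fctr_eq_forget_twix_tdd: "fctr_eq A (comp_fctr forget_tdd (twix_tdd C)) twix"
  by (auto simp: fctr_eq_def comp_fctr_def forget_tdd_def twix_tdd_def twix_def)

context category
begin

text \<open>Two commuting squares paste to a commuting rectangle. Every compatibility condition on
  morphisms below is such a square, so this gives closure under composition in all three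
  categories.\<close>

lemma Comp_intertwine:
  assumes "Comp C X X' Y' f' a = Comp C X Y Y' b f"
    and "Comp C Y Y' Z' g' b = Comp C Y Z Z' c g"
    and "X \<in> Ob C" "X' \<in> Ob C" "Y \<in> Ob C" "Y' \<in> Ob C" "Z \<in> Ob C" "Z' \<in> Ob C"
    and "f \<in> Hom C X Y" "g \<in> Hom C Y Z" "f' \<in> Hom C X' Y'" "g' \<in> Hom C Y' Z'"
    and "a \<in> Hom C X X'" "b \<in> Hom C Y Y'" "c \<in> Hom C Z Z'"
  shows "Comp C X X' Z' (Comp C X' Y' Z' g' f') a = Comp C X Z Z' c (Comp C X Y Z g f)"
proof -
  have "Comp C X X' Z' (Comp C X' Y' Z' g' f') a = Comp C X Y' Z' g' (Comp C X Y Y' b f)"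
    using assms by (simp add: Comp_assoc)
  also have "\<dots> = Comp C X Z Z' c (Comp C X Y Z g f)"
    using assms by (simp add: Comp_assoc [symmetric])
  finally show ?thesis .
qed

lemma category_tcat: "category (tcat C F)"
proof
  fix X Y Z f g
  assume "X \<in> Ob (tcat C F)" "Y \<in> Ob (tcat C F)" "Z \<in> Ob (tcat C F)"
    and "f \<in> Hom (tcat C F) X Y" "g \<in> Hom (tcat C F) Y Z"
  then show "Comp (tcat C F) X Y Z g f \<in> Hom (tcat C F) X Z"
    by (auto simp: tcat_def Comp_in_Hom intro!: Comp_intertwine [symmetric])
qed (auto simp: tcat_def Ident_in_Hom Comp_Ident_left Comp_Ident_right Comp_assoc)

lemma category_mcat: "category (mcat C F)"
proof
  fix X Y Z f g
  assume "X \<in> Ob (mcat C F)" "Y \<in> Ob (mcat C F)" "Z \<in> Ob (mcat C F)"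
    and "f \<in> Hom (mcat C F) X Y" "g \<in> Hom (mcat C F) Y Z"
  then show "Comp (mcat C F) X Y Z g f \<in> Hom (mcat C F) X Z"
    by (auto simp: mcat_def Comp_in_Hom intro!: Comp_intertwine [symmetric])
qed (auto simp: mcat_def Ident_in_Hom Comp_Ident_left Comp_Ident_right Comp_assoc)

lemma category_mcat_tdd: "category (mcat_tdd C F)"
proof -
  interpret M: category "mcat C F" by (rule category_mcat)
  show ?thesis
  proof
    fix X Y Z f g
    assume "X \<in> Ob (mcat_tdd C F)" "Y \<in> Ob (mcat_tdd C F)" "Z \<in> Ob (mcat_tdd C F)"
      and "f \<in> Hom (mcat_tdd C F) X Y" "g \<in> Hom (mcat_tdd C F) Y Z"
    then show "Comp (mcat_tdd C F) X Y Z g f \<in> Hom (mcat_tdd C F) X Z"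
      by (auto simp: mcat_tdd_def mcat_def descent_datum_def twist_def Comp_in_Hom
          intro!: Comp_intertwine [symmetric])
  next
    fix X assume "X \<in> Ob (mcat_tdd C F)"
    then show "Ident (mcat_tdd C F) X \<in> Hom (mcat_tdd C F) X X"
      by (auto simp: mcat_tdd_def mcat_def descent_datum_def twist_def
          Ident_in_Hom Comp_Ident_left Comp_Ident_right)
  qed (auto simp: mcat_tdd_def M.Comp_Ident_left M.Comp_Ident_right M.Comp_assoc)
qed

lemma cat_functor_twix: "cat_functor (tcat C F) (mcat C F) twix"
proof -
  interpret T: category "tcat C F" by (rule category_tcat)
  interpret M: category "mcat C F" by (rule category_mcat)
  show ?thesis
    by standard (auto simp: tcat_def mcat_def twix_def)
qed

lemma cat_functor_forget_tdd: "cat_functor (mcat_tdd C F) (mcat C F) forget_tdd"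
proof -
  interpret D: category "mcat_tdd C F" by (rule category_mcat_tdd)
  interpret M: category "mcat C F" by (rule category_mcat)
  show ?thesis
    by standard (auto simp: mcat_tdd_def forget_tdd_def)
qed

text \<open>Since \<open>twist\<close> fixes \<open>(X, X, \<phi>, \<phi>)\<close>, the identity is
  a descent datum there, and \<open>(f, f)\<close> respects identity data by the unit laws.\<close>

lemma cat_functor_twix_tdd: "cat_functor (tcat C F) (mcat_tdd C F) (twix_tdd C)"
proof -
  interpret T: category "tcat C F" by (rule category_tcat)
  interpret D: category "mcat_tdd C F" by (rule category_mcat_tdd)
  show ?thesis
    by standard (auto simp: tcat_def mcat_tdd_def mcat_def twix_tdd_def twist_def
        descent_datum_def Ident_in_Hom Comp_Ident_left Comp_Ident_right)
qed

text \<open>The two components of the equation \<open>\<tau>f f = id\<close> are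
  \<open>f2 f1 = id\<close> and \<open>f1 f2 = id\<close>.\<close>

lemma Ob_mcat_tddD:
  assumes "((X1, X2, \<phi>1, \<phi>2), (f1, f2)) \<in> Ob (mcat_tdd C F)"
  shows "X1 \<in> Ob C" "X2 \<in> Ob C" "\<phi>1 \<in> Hom C X1 X2" "\<phi>2 \<in> Hom C X2 X1"
    and "f1 \<in> Hom C X1 X2" "f2 \<in> Hom C X2 X1"
    and "Comp C X1 X2 X1 \<phi>2 \<phi>1 = F X1" "Comp C X2 X1 X2 \<phi>1 \<phi>2 = F X2"
    and "Comp C X1 X2 X1 \<phi>2 f1 = Comp C X1 X2 X1 f2 \<phi>1"
    and "Comp C X2 X1 X2 \<phi>1 f2 = Comp C X2 X1 X2 f1 \<phi>2"
    and "Comp C X1 X2 X1 f2 f1 = Ident C X1" "Comp C X2 X1 X2 f1 f2 = Ident C X2"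
  using assms by (auto simp: mcat_tdd_def mcat_def descent_datum_def twist_def)

text \<open>Write \<open>\<theta> = \<phi>2 f1\<close>. The first equation makes
  \<open>(X1, \<theta>)\<close> an object of \<open>tcat C F\<close>; the other two make
  \<open>(id, f1)\<close> and \<open>(id, f2)\<close> morphisms between
  \<open>(X1, X1, \<theta>, \<theta>)\<close> and \<open>(X1, X2, \<phi>1, \<phi>2)\<close>.\<close>

lemma Comp_datum_square:
  assumes "((X1, X2, \<phi>1, \<phi>2), (f1, f2)) \<in> Ob (mcat_tdd C F)"
  shows "Comp C X1 X1 X1 (Comp C X1 X2 X1 \<phi>2 f1) (Comp C X1 X2 X1 \<phi>2 f1) = F X1"
    and "Comp C X1 X1 X2 f1 (Comp C X1 X2 X1 \<phi>2 f1) = \<phi>1"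
    and "Comp C X2 X1 X1 (Comp C X1 X2 X1 \<phi>2 f1) f2 = \<phi>2"
proof -
  note ob = Ob_mcat_tddD [OF assms]
  show *: "Comp C X1 X1 X2 f1 (Comp C X1 X2 X1 \<phi>2 f1) = \<phi>1"
  proof -
    \<comment> \<open>Replacing \<open>\<phi>2 f1\<close> by \<open>f2 \<phi>1\<close> puts
      \<open>f1\<close> next to its inverse.\<close>
    have "Comp C X1 X1 X2 f1 (Comp C X1 X2 X1 \<phi>2 f1) = Comp C X1 X1 X2 f1 (Comp C X1 X2 X1 f2 \<phi>1)"
      using ob by simp
    also have "\<dots> = \<phi>1"
      using ob by (simp add: Comp_assoc [symmetric] Comp_Ident_left)
    finally show ?thesis .
  qed
  \<comment> \<open>Reassociated, the square is
    \<open>\<phi>2 (f1 \<theta>) = \<phi>2 \<phi>1\<close>.\<close>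
  show "Comp C X1 X1 X1 (Comp C X1 X2 X1 \<phi>2 f1) (Comp C X1 X2 X1 \<phi>2 f1) = F X1"
    using ob(1-6) by (simp add: Comp_assoc Comp_in_Hom * ob(7))
  show "Comp C X2 X1 X1 (Comp C X1 X2 X1 \<phi>2 f1) f2 = \<phi>2"
    using ob(1-6) by (simp add: Comp_assoc Comp_Ident_right ob(12))
qed

lemma cat_functor_untwix_tdd: "cat_functor (mcat_tdd C F) (tcat C F) (untwix_tdd C)"
proof -
  interpret T: category "tcat C F" by (rule category_tcat)
  interpret D: category "mcat_tdd C F" by (rule category_mcat_tdd)
  show ?thesis
  proof
    fix X assume "X \<in> Ob (mcat_tdd C F)"
    moreover obtain X1 X2 \<phi>1 \<phi>2 f1 f2 where "X = ((X1, X2, \<phi>1, \<phi>2), (f1, f2))"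
      by (metis surj_pair)
    ultimately show "on_ob (untwix_tdd C) X \<in> Ob (tcat C F)"
      using Ob_mcat_tddD Comp_datum_square(1)
      by (simp add: untwix_tdd_def tcat_def Comp_in_Hom)
  next
    \<comment> \<open>For \<open>f = (u1, u2)\<close>, paste the square of the descent data,
      \<open>g1 u1 = u2 f1\<close>, with the square \<open>\<psi>2 u2 = u1 \<phi>2\<close>.\<close>
    fix X Y f assume "X \<in> Ob (mcat_tdd C F)" "Y \<in> Ob (mcat_tdd C F)" "f \<in> Hom (mcat_tdd C F) X Y"
    then show "on_hom (untwix_tdd C) X Y f
        \<in> Hom (tcat C F) (on_ob (untwix_tdd C) X) (on_ob (untwix_tdd C) Y)"
      by (auto simp: untwix_tdd_def tcat_def mcat_tdd_def mcat_def descent_datum_def twist_def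
          intro!: Comp_intertwine)
  qed (auto simp: untwix_tdd_def tcat_def mcat_tdd_def mcat_def)
qed

text \<open>The round trip sends \<open>(X, \<phi>)\<close> to \<open>(X, \<phi> id)\<close>, which
  is \<open>(X, \<phi>)\<close> again, so identities serve as components.\<close>

lemma natural_iso_untwix_twix:
  "natural_iso (tcat C F) (tcat C F) id_fctr (comp_fctr (untwix_tdd C) (twix_tdd C))
    (\<lambda>(X, _). Ident C X)"
  by (auto simp: natural_iso_def is_iso_def id_fctr_def comp_fctr_def untwix_tdd_def twix_tdd_def
      tcat_def Ident_in_Hom Comp_Ident_left Comp_Ident_right intro!: bexI [of _ "Ident C _"])

lemma natural_iso_twix_untwix:
  "natural_iso (mcat_tdd C F) (mcat_tdd C F) (comp_fctr (twix_tdd C) (untwix_tdd C)) id_fctr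
    (\<lambda>((X1, _), (f1, _)). (Ident C X1, f1))"
  unfolding natural_iso_def
proof (intro conjI ballI)
  fix X assume X: "X \<in> Ob (mcat_tdd C F)"
  obtain X1 X2 \<phi>1 \<phi>2 f1 f2 where X_eq: "X = ((X1, X2, \<phi>1, \<phi>2), (f1, f2))"
    by (metis surj_pair)
  note ob = Ob_mcat_tddD [OF X [unfolded X_eq]] Comp_datum_square [OF X [unfolded X_eq]]
  show "is_iso (mcat_tdd C F) (on_ob (comp_fctr (twix_tdd C) (untwix_tdd C)) X)
      (on_ob id_fctr X) ((\<lambda>((X1, _), (f1, _)). (Ident C X1, f1)) X)"
    unfolding is_iso_def
    \<comment> \<open>The inverse uses \<open>f2\<close>, the inverse of \<open>f1\<close>.
      Compatibility of both maps with the data \<open>(id, id)\<close> and \<open>(f1, f2)\<close>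
      comes down to \<open>f2 f1 = id\<close>.\<close>
    by (intro conjI bexI [of _ "(Ident C X1, f2)"])
      (use ob in \<open>simp_all add: X_eq id_fctr_def comp_fctr_def untwix_tdd_def twix_tdd_def
        mcat_tdd_def mcat_def twist_def Ident_in_Hom Comp_in_Hom Comp_Ident_left Comp_Ident_right\<close>)
next
  \<comment> \<open>The first component of naturality is a unit law; the second,
    \<open>g1 u1 = u2 f1\<close>, is the compatibility of \<open>u\<close> with the descent
    data.\<close>
  fix X Y u assume "X \<in> Ob (mcat_tdd C F)" "Y \<in> Ob (mcat_tdd C F)" "u \<in> Hom (mcat_tdd C F) X Y"
  then show "Comp (mcat_tdd C F) (on_ob (comp_fctr (twix_tdd C) (untwix_tdd C)) X)
       (on_ob (comp_fctr (twix_tdd C) (untwix_tdd C)) Y) (on_ob id_fctr Y)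
       ((\<lambda>((X1, _), (f1, _)). (Ident C X1, f1)) Y)
       (on_hom (comp_fctr (twix_tdd C) (untwix_tdd C)) X Y u) =
     Comp (mcat_tdd C F) (on_ob (comp_fctr (twix_tdd C) (untwix_tdd C)) X) (on_ob id_fctr X)
       (on_ob id_fctr Y) (on_hom id_fctr X Y u) ((\<lambda>((X1, _), (f1, _)). (Ident C X1, f1)) X)"
    by (auto simp: id_fctr_def comp_fctr_def untwix_tdd_def twix_tdd_def
        mcat_tdd_def mcat_def twist_def Comp_Ident_left Comp_Ident_right)
qed

lemma cat_equivalence_twix_tdd: "cat_equivalence (tcat C F) (mcat_tdd C F) (twix_tdd C)"
  unfolding cat_equivalence_def
  using cat_functor_twix_tdd cat_functor_untwix_tdd natural_iso_untwix_twix natural_iso_twix_untwix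
  by blast

end

theorem proposition6p2:
  fixes C :: "('o, 'm) cat" and F :: "'o \<Rightarrow> 'm"
  assumes "category C" and "id_endomorphism C F"
  shows "cat_functor (tcat C F) (mcat C F) twix \<and>
    cat_functor (mcat_tdd C F) (mcat C F) forget_tdd \<and>
    (\<exists>\<alpha>. cat_equivalence (tcat C F) (mcat_tdd C F) \<alpha> \<and>
         fctr_eq (tcat C F) (comp_fctr forget_tdd \<alpha>) twix)"
proof -
  interpret category C by (rule assms(1))
  show ?thesis
    using cat_functor_twix cat_functor_forget_tdd cat_equivalence_twix_tdd fctr_eq_forget_twix_tdd
    by blast
qed

end
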